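(* Let $m$ and $r$ be positive integers, and let $\mathbf{v}$ be an admissible vector (with respect to $\|\cdot\|_1$) in $V=(\mathbb{Z}/m\mathbb{Z})^r$ whose norm $\|\mathbf{v}\|_1$ is maximal among all admissible vectors in $V$. Then $$\|\mathbf{v}\|_1=\frac{mr-m-r+\gcd(m,r)}{2}.$$
   Context: For $x\in\mathbb{Z}/m\mathbb{Z}$ let $\bar{x}\in\{0,1,\ldots,m-1\}$ be its least nonnegative residue. For $\mathbf{v}=(v_1,\ldots,v_r)\in(\mathbb{Z}/m\mathbb{Z})^r$ put $\|\mathbf{v}\|_1=\sum_{i=1}^r\bar{v_i}$ (an integer). Let $\mathbf{e}=(1,1,\ldots,1)\in(\mathbb{Z}/m\mathbb{Z})^r$. A vector $\mathbf{v}$ is called admissible (with respect to $\|\cdot\|_1$) if $\|\mathbf{v}\|_1\le\|\mathbf{v}+x\mathbf{e}\|_1$ for all $x\in\mathbb{Z}/m\mathbb{Z}$. *)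

theory Defs
  imports Complex_Main "HOL-Library.FuncSet" "HOL-Number_Theory.Residues"
begin

text \<open>
  The ring \<open>\<int>/m\<int>\<close> is the library's \<^const>\<open>residue_ring\<close>, whose carrier is the set
  \<open>{0..m - 1}\<close> of least nonnegative residues; an element therefore is its own residue.
  Vectors are extensional functions on the index set \<open>{1..r}\<close>.
\<close>

definition residue_vectors :: "nat \<Rightarrow> nat \<Rightarrow> (nat \<Rightarrow> int) set" where
  "residue_vectors m r = {1..r} \<rightarrow>\<^sub>E carrier (residue_ring (int m))"

definition vec_add :: "nat \<Rightarrow> nat \<Rightarrow> (nat \<Rightarrow> int) \<Rightarrow> (nat \<Rightarrow> int) \<Rightarrow> (nat \<Rightarrow> int)" where
  "vec_add m r v w = (\<lambda>i\<in>{1..r}. v i \<oplus>\<^bsub>residue_ring (int m)\<^esub> w i)"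

definition vec_scale :: "nat \<Rightarrow> nat \<Rightarrow> int \<Rightarrow> (nat \<Rightarrow> int) \<Rightarrow> (nat \<Rightarrow> int)" where
  "vec_scale m r x v = (\<lambda>i\<in>{1..r}. x \<otimes>\<^bsub>residue_ring (int m)\<^esub> v i)"

text \<open>
  For \<open>m = 1\<close> the library's \<open>\<one>\<^bsub>residue_ring 1\<^esub>\<close> is the integer \<open>1\<close>, which lies outside the
  carrier \<open>{0}\<close>; reducing modulo \<open>m\<close> gives the correct unit also in this case.
\<close>

definition ones_vec :: "nat \<Rightarrow> nat \<Rightarrow> (nat \<Rightarrow> int)" where
  "ones_vec m r = (\<lambda>i\<in>{1..r}. 1 mod int m)"

definition norm1 :: "nat \<Rightarrow> (nat \<Rightarrow> int) \<Rightarrow> int" where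
  "norm1 r v = (\<Sum>i=1..r. v i)"

definition admissible :: "nat \<Rightarrow> nat \<Rightarrow> (nat \<Rightarrow> int) \<Rightarrow> bool" where
  "admissible m r v \<longleftrightarrow>
     v \<in> residue_vectors m r \<and>
     (\<forall>x\<in>carrier (residue_ring (int m)).
        norm1 r v \<le> norm1 r (vec_add m r v (vec_scale m r x (ones_vec m r))))"

end

theory Submission
  imports Defs
begin

text \<open>
  Write \<open>N x\<close> for the norm of \<open>v + x e\<close>. Since \<open>N x - N 0 \<equiv> r x\<close> modulo \<open>m\<close>, admissibility
  forces \<open>N x - N 0 \<ge> (r x) mod m\<close>. Summing over all residues \<open>x\<close>, where the left-hand sides
  contribute \<open>r m (m - 1) / 2 - m N 0\<close> and the right-hand sides \<open>m (m - gcd m r) / 2\<close>, gives the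
  upper bound. The vector with entries \<open>\<lfloor>m (r - i) / r\<rfloor>\<close> attains equality for every \<open>x\<close>.
\<close>

text \<open>The adjunction between floor division and multiplication; it clears the floors from the
  entries of the extremal vector and from the count of wrapping entries.\<close>

lemma le_div_iff_mult_le_int:
  fixes a b c :: int
  assumes "c > 0"
  shows "a \<le> b div c \<longleftrightarrow> a * c \<le> b"
proof -
  have "(b - a * c) div c = b div c - a"
    using assms div_mult_self1[of c b "- a"] by simp
  then show ?thesis
    using pos_imp_zdiv_nonneg_iff[OF assms, of "b - a * c"] by auto
qed

text \<open>Translation by \<open>a\<close> permutes the residues.\<close>

lemma sum_shift_mod:
  fixes m a :: int
  assumes "m > 0"
  shows "2 * (\<Sum>x\<in>{0..<m}. (a + x) mod m) = m * (m - 1)"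
proof -
  have "(\<Sum>x\<in>{0..<m}. (a + x) mod m) = \<Sum>{0..<m}"
    by (rule sum.reindex_bij_witness[of _ "\<lambda>y. (y - a) mod m" "\<lambda>x. (a + x) mod m"])
      (use assms in \<open>auto simp: mod_simps\<close>)
  also have "\<dots> = \<Sum>(int ` {0..<nat m})"
    using assms by (simp add: image_int_atLeastLessThan)
  also have "\<dots> = (\<Sum>k = 0..<nat m. int k)"
    by (simp add: sum.reindex)
  also have "2 * \<dots> = m * (m - 1)"
  proof -
    have "2 * (\<Sum>k = 0..<n. int k) = int n * (int n - 1)" for n
      by (induction n) (simp_all add: algebra_simps)
    then show ?thesis
      using assms by simp
  qed
  finally show ?thesis .
qed

text \<open>Dividing \<open>m\<close> and \<open>r\<close> by their gcd \<open>d\<close> leaves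
  coprime \<open>k\<close> and \<open>s\<close>, so the condition becomes \<open>k dvd x\<close>;
  below \<open>m = k * d\<close> there are \<open>d\<close> such multiples.\<close>

lemma card_dvd_mult_residues:
  fixes m r :: int
  assumes "m > 0"
  shows "int (card {x\<in>{0..<m}. m dvd r * x}) = gcd m r"
proof -
  define d where "d = gcd m r"
  have d: "d > 0"
    using assms by (simp add: d_def)
  obtain k s where ks: "m = k * d" "r = s * d" "coprime k s"
    using gcd_coprime_exists[of m r] d unfolding d_def by (metis less_irrefl)
  have k: "k > 0"
    using assms d ks(1) by (simp add: zero_less_mult_iff)
  have "m dvd r * x \<longleftrightarrow> k dvd x" for x
  proof -
    have "m dvd r * x \<longleftrightarrow> d * k dvd d * (s * x)"
      by (simp add: ks mult_ac)
    also have "\<dots> \<longleftrightarrow> k dvd s * x"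
      using d by simp
    also have "\<dots> \<longleftrightarrow> k dvd x"
      using ks(3) by (simp add: coprime_dvd_mult_right_iff)
    finally show ?thesis .
  qed
  moreover have "k * j \<in> {0..<m} \<longleftrightarrow> j \<in> {0..<d}" for j
    using k by (simp add: ks(1) zero_le_mult_iff)
  ultimately have "{x\<in>{0..<m}. m dvd r * x} = (\<lambda>j. k * j) ` {0..<d}"
    by (auto simp del: atLeastLessThan_iff elim!: dvdE)
  moreover have "inj_on (\<lambda>j. k * j) {0..<d}"
    using k by (auto simp: inj_on_def)
  ultimately show ?thesis
    using d by (simp add: card_image d_def)
qed

text \<open>Pair \<open>x\<close> with \<open>-x\<close>: the residues of \<open>r * x\<close> and
  \<open>-(r * x)\<close> add up to \<open>m\<close>, unless \<open>m\<close> divides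
  \<open>r * x\<close>, when both vanish.\<close>

lemma sum_mult_mod:
  fixes m r :: int
  assumes "m > 0"
  shows "2 * (\<Sum>x\<in>{0..<m}. (r * x) mod m) = m * (m - gcd m r)"
proof -
  have neg: "(- (r * (- x mod m))) mod m = (r * x) mod m" for x
    using mod_mult_right_eq[of "- r" "- x" m] by simp
  have "(\<Sum>x\<in>{0..<m}. (r * x) mod m) = (\<Sum>x\<in>{0..<m}. (- (r * x)) mod m)"
    by (rule sum.reindex_bij_witness[of _ "\<lambda>x. (- x) mod m" "\<lambda>x. (- x) mod m"])
      (use assms in \<open>auto simp: neg mod_minus_eq\<close>)
  then have "2 * (\<Sum>x\<in>{0..<m}. (r * x) mod m)
      = (\<Sum>x\<in>{0..<m}. (r * x) mod m + (- (r * x)) mod m)"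
    by (simp add: sum.distrib)
  also have "\<dots> = (\<Sum>x\<in>{0..<m}. m - (if m dvd r * x then m else 0))"
    by (intro sum.cong refl) (auto simp: zmod_zminus1_eq_if dvd_eq_mod_eq_0)
  also have "\<dots> = m * m - m * int (card {x\<in>{0..<m}. m dvd r * x})"
    using assms by (simp add: sum_subtractf sum.inter_filter[symmetric])
  also have "\<dots> = m * (m - gcd m r)"
    by (simp only: card_dvd_mult_residues[OF assms] right_diff_distrib)
  finally show ?thesis .
qed

lemma residue_vectors_iff:
  assumes "m > 0"
  shows "v \<in> residue_vectors m r \<longleftrightarrow> v \<in> {1..r} \<rightarrow>\<^sub>E {0..<int m}"
proof -
  have "{0..int m - 1} = {0..<int m}"
    by auto
  then show ?thesis
    by (simp add: residue_vectors_def residue_ring_def)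
qed

lemma norm1_translate:
  "norm1 r (vec_add m r v (vec_scale m r x (ones_vec m r))) = (\<Sum>i=1..r. (v i + x) mod int m)"
  by (auto simp: norm1_def vec_add_def vec_scale_def ones_vec_def residue_ring_def mod_simps
      intro!: sum.cong)

lemma admissible_iff:
  assumes "m > 0"
  shows "admissible m r v \<longleftrightarrow> v \<in> {1..r} \<rightarrow>\<^sub>E {0..<int m} \<and>
    (\<forall>x\<in>{0..<int m}. norm1 r v \<le> (\<Sum>i=1..r. (v i + x) mod int m))"
proof -
  have "carrier (residue_ring (int m)) = {0..<int m}"
    by (auto simp: residue_ring_def)
  then show ?thesis
    by (simp add: admissible_def residue_vectors_iff[OF assms] norm1_translate)
qed

text \<open>After swapping the sums, each coordinate runs through all residues once, so the total
  does not depend on \<open>v\<close>.\<close>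

lemma sum_translate_norms:
  assumes "m > 0"
  shows "2 * (\<Sum>x\<in>{0..<int m}. \<Sum>i=1..r. (v i + x) mod int m) = int r * (int m * (int m - 1))"
proof -
  have "2 * (\<Sum>x\<in>{0..<int m}. \<Sum>i=1..r. (v i + x) mod int m)
      = (\<Sum>i=1..r. 2 * (\<Sum>x\<in>{0..<int m}. (v i + x) mod int m))"
    by (subst sum.swap) (simp add: sum_distrib_left)
  also have "\<dots> = int r * (int m * (int m - 1))"
    using assms by (simp add: sum_shift_mod)
  finally show ?thesis .
qed

lemma admissible_norm1_le:
  assumes "m > 0" "admissible m r v"
  shows "2 * norm1 r v \<le> int m * int r - int m - int r + gcd (int m) (int r)"
proof -
  let ?N = "\<lambda>x. \<Sum>i=1..r. (v i + x) mod int m"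
  have "norm1 r v + (int r * x) mod int m \<le> ?N x" if x: "x \<in> {0..<int m}" for x
  proof -
    have "?N x mod int m = (\<Sum>i=1..r. v i + x) mod int m"
      by (simp add: mod_sum_eq)
    also have "\<dots> = (norm1 r v + int r * x) mod int m"
      by (simp add: norm1_def sum.distrib)
    finally have "(?N x - norm1 r v) mod int m = (int r * x) mod int m"
      by (metis add_diff_cancel_left' mod_diff_left_eq)
    \<comment> \<open>Admissibility makes the difference nonnegative, and a nonnegative integer is
      at least its residue.\<close>
    moreover have "(?N x - norm1 r v) mod int m \<le> ?N x - norm1 r v"
      using assms x by (intro zmod_le_nonneg_dividend) (auto simp: admissible_iff)
    ultimately show ?thesis
      by linarith
  qed
  then have "(\<Sum>x\<in>{0..<int m}. norm1 r v + (int r * x) mod int m) \<le> (\<Sum>x\<in>{0..<int m}. ?N x)"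
    by (rule sum_mono)
  then have "2 * (int m * norm1 r v) + 2 * (\<Sum>x\<in>{0..<int m}. (int r * x) mod int m)
      \<le> 2 * (\<Sum>x\<in>{0..<int m}. ?N x)"
    by (simp add: sum.distrib)
  then have "int m * (2 * norm1 r v) \<le> int m * (int m * int r - int m - int r + gcd (int m) (int r))"
    unfolding sum_translate_norms[OF assms(1)] using sum_mult_mod[of "int m" "int r"] assms(1)
    by (simp add: algebra_simps)
  then show ?thesis
    using assms(1) by simp
qed

text \<open>Rounded-down equally spaced points of [0, m), in decreasing order so that the entries
  that wrap form an initial segment of the indices.\<close>

definition extremal_vec :: "nat \<Rightarrow> nat \<Rightarrow> nat \<Rightarrow> int" where
  "extremal_vec m r = (\<lambda>i\<in>{1..r}. (int m * (int r - int i)) div int r)"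

lemma extremal_vec_range:
  assumes "m > 0"
  shows "extremal_vec m r \<in> {1..r} \<rightarrow>\<^sub>E {0..<int m}"
proof -
  have "0 \<le> (int m * (int r - int i)) div int r \<and> (int m * (int r - int i)) div int r < int m"
    if i: "i \<in> {1..r}" for i
  proof -
    \<comment> \<open>Strict because indices start at 1; index 0 would give the value
      \<open>m\<close>, which is not a residue.\<close>
    have "int m * (int r - int i) < int m * int r"
      using assms i by (intro mult_strict_left_mono) auto
    then show ?thesis
      using i le_div_iff_mult_le_int[of "int r" "int m" "int m * (int r - int i)"]
      by (auto simp: pos_imp_zdiv_nonneg_iff)
  qed
  then show ?thesis
    by (auto simp: extremal_vec_def)
qed

text \<open>
  Adding \<open>x\<close> to the \<open>i\<close>-th entry wraps around iff \<open>i \<le> r x / m\<close>, so exactly \<open>\<lfloor>r x / m\<rfloor>\<close>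
  entries do.
\<close>

lemma norm1_extremal_vec_translate:
  assumes "r > 0" "x \<in> {0..<int m}"
  shows "(\<Sum>i=1..r. (extremal_vec m r i + x) mod int m)
    = norm1 r (extremal_vec m r) + (int r * x) mod int m"
proof -
  have m: "m > 0"
    using assms by auto
  let ?q = "(int r * x) div int m"
  \<comment> \<open>These bounds keep \<open>{1..nat ?q}\<close> inside the index set and make its
    cardinality exactly \<open>?q\<close>.\<close>
  have q: "0 \<le> ?q" "?q \<le> int r"
  proof -
    show "0 \<le> ?q"
      using assms by (simp add: pos_imp_zdiv_nonneg_iff)
    have "int r * x \<le> int r * int m"
      using assms by (intro mult_left_mono) auto
    then have "?q \<le> (int r * int m) div int m"
      using m by (intro zdiv_mono1) auto
    then show "?q \<le> int r"
      using m by simp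
  qed
  have "(extremal_vec m r i + x) mod int m
      = extremal_vec m r i + x - (if int i \<le> ?q then int m else 0)" if i: "i \<in> {1..r}" for i
  proof -
    have range: "0 \<le> extremal_vec m r i" "extremal_vec m r i < int m"
      using extremal_vec_range[OF m, of r] i by (auto simp: PiE_iff)
    \<comment> \<open>Clearing the floor of the entry and cancelling \<open>m * r\<close> leaves
      \<open>i * m <= r * x\<close>, which folds back into a floor.\<close>
    have "int m - x \<le> extremal_vec m r i \<longleftrightarrow> (int m - x) * int r \<le> int m * (int r - int i)"
      using i assms(1) by (simp add: extremal_vec_def le_div_iff_mult_le_int)
    also have "\<dots> \<longleftrightarrow> int i * int m \<le> int r * x"
      by (simp add: algebra_simps)
    also have "\<dots> \<longleftrightarrow> int i \<le> ?q"
      using m by (simp add: le_div_iff_mult_le_int)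
    finally have wrap: "int m \<le> extremal_vec m r i + x \<longleftrightarrow> int i \<le> ?q"
      by linarith
    show ?thesis
    proof (cases "int i \<le> ?q")
      case True
      then have "(extremal_vec m r i + x - int m) mod int m = extremal_vec m r i + x - int m"
        using wrap range assms(2) by (intro mod_pos_pos_trivial) auto
      then show ?thesis
        using True by simp
    next
      case False
      then show ?thesis
        using wrap range assms(2) by simp
    qed
  qed
  then have "(\<Sum>i=1..r. (extremal_vec m r i + x) mod int m)
      = (\<Sum>i=1..r. extremal_vec m r i + x - (if int i \<le> ?q then int m else 0))"
    by (rule sum.cong[OF refl])
  also have "\<dots> = norm1 r (extremal_vec m r) + int r * x
      - int m * int (card {i\<in>{1..r}. int i \<le> ?q})"
    by (simp add: norm1_def sum.distrib sum_subtractf sum.inter_filter[symmetric])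
  also have "{i\<in>{1..r}. int i \<le> ?q} = {1..nat ?q}"
    using q by auto
  also have "int (card {1..nat ?q}) = ?q"
    using q by simp
  also have "norm1 r (extremal_vec m r) + int r * x - int m * ?q
      = norm1 r (extremal_vec m r) + (int r * x) mod int m"
    by (simp add: minus_mult_div_eq_mod[symmetric])
  finally show ?thesis .
qed

text \<open>Translation by \<open>x\<close> raises the norm by a residue, which is
  nonnegative.\<close>

lemma admissible_extremal_vec:
  assumes "m > 0" "r > 0"
  shows "admissible m r (extremal_vec m r)"
  unfolding admissible_iff[OF assms(1)]
  using assms by (simp add: extremal_vec_range norm1_extremal_vec_translate del: One_nat_def)

text \<open>Repeating the summation of the upper bound with equalities determines the norm without
  evaluating the sum of floors.\<close>

lemma norm1_extremal_vec:
  assumes "m > 0" "r > 0"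
  shows "2 * norm1 r (extremal_vec m r) = int m * int r - int m - int r + gcd (int m) (int r)"
proof -
  have "int r * (int m * (int m - 1))
      = 2 * (\<Sum>x\<in>{0..<int m}. norm1 r (extremal_vec m r) + (int r * x) mod int m)"
    using sum_translate_norms[OF assms(1), of "extremal_vec m r" r] assms(2)
    by (simp add: norm1_extremal_vec_translate del: One_nat_def)
  also have "\<dots> = 2 * (int m * norm1 r (extremal_vec m r)) + int m * (int m - gcd (int m) (int r))"
    using sum_mult_mod[of "int m" "int r"] assms(1) by (simp add: sum.distrib)
  finally have "int m * (2 * norm1 r (extremal_vec m r))
      = int m * (int m * int r - int m - int r + gcd (int m) (int r))"
    by (simp add: algebra_simps)
  then show ?thesis
    using assms(1) by simp
qed

theorem theorem2p5:
  fixes m r :: nat and v :: "nat \<Rightarrow> int"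
  assumes "m > 0" and "r > 0"
    and "admissible m r v"
    and "\<And>w. admissible m r w \<Longrightarrow> norm1 r w \<le> norm1 r v"
  shows "real_of_int (norm1 r v) =
           (real m * real r - real m - real r + real (gcd m r)) / 2"
proof -
  \<comment> \<open>Maximality gives the lower bound, by comparison with the extremal vector; the
    upper bound holds for every admissible vector.\<close>
  have "norm1 r (extremal_vec m r) \<le> norm1 r v"
    using assms by (intro assms(4) admissible_extremal_vec)
  then have "2 * norm1 r v = int m * int r - int m - int r + int (gcd m r)"
    using admissible_norm1_le[OF assms(1,3)] norm1_extremal_vec[OF assms(1,2)] by simp
  then have "real_of_int (2 * norm1 r v) = real_of_int (int m * int r - int m - int r + int (gcd m r))"
    by (rule arg_cong)
  then show ?thesis
    by simp
qed

end
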